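(* Let $k_1,\dots,k_n\in\mathbb{N}_0$. Then the renormalized $q$-multiple zeta value $$\mathfrak{z}_+(-k_1,\dots,-k_n):=\lim_{z\to0}\frac{(-1)^{k_1+\cdots+k_n}}{z^{k_1+\cdots+k_n}}\,\psi_+(d^{k_1}y\cdots d^{k_n}y)(z)$$ is well defined (the limit exists), and $$\mathfrak{z}_+(-k_1,\dots,-k_n)=\zeta_+(-k_1,\dots,-k_n).$$ In particular, the renormalized $q$-multiple zeta values respect the product $\diamond_0$: extending $\mathfrak{z}_+$ linearly to $\langle Y\rangle_{\mathbb{Q}}$ by $\mathfrak{z}_+(\mathbf{1})=1$ and $\mathfrak{z}_+(d^{k_1}y\cdots d^{k_n}y):=\mathfrak{z}_+(-k_1,\dots,-k_n)$, one has $\mathfrak{z}_+(u\diamond_0 v)=\mathfrak{z}_+(u)\,\mathfrak{z}_+(v)$ for all $u,v\in Y$.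
   Context: Words: Let $L=\{d,y\}$, $L^*$ the free monoid on $L$ with empty word $\mathbf{1}$, $\mathbb{Q}\langle L\rangle$ the free associative algebra, $\mathcal{T}_-:=\langle wd:w\in L^*\rangle_{\mathbb{Q}}$, $Y:=L^*y\cup\{\mathbf{1}\}$. Depth is the number of letters $y$ in a word. Laurent series and Birkhoff decomposition: $\mathcal{A}=\mathbb{Q}[z^{-1},z]]=\mathcal{A}_-\oplus\mathcal{A}_+$ with $\mathcal{A}_-=z^{-1}\mathbb{Q}[z^{-1}]$, $\mathcal{A}_+=\mathbb{Q}[[z]]$, and $\pi:\mathcal{A}\to\mathcal{A}_-$ the projection along $\mathcal{A}_+$. For a connected graded Hopf algebra $H$ with coproduct $\Delta$, counit $\varepsilon$, and an algebra morphism (character) $\chi:H\to\mathcal{A}$, put $f\star g=m_{\mathcal{A}}(f\otimes g)\Delta$, $e=\eta_{\mathcal{A}}\circ\varepsilon$. There is a unique decomposition $\chi=\chi_-^{\star(-1)}\star\chi_+$ with characters $\chi_-:H\to\mathbb{Q}\oplus\mathcal{A}_-$, $\chi_+:H\to\mathcal{A}_+$ such that $\chi_-=e-\pi(\chi_-\star(\chi-e))$, $\chi_+=e+(\mathrm{Id}-\pi)(\chi_-\star(\chi-e))$. Classical side: the bilinear product $\diamond_0$ on $\mathbb{Q}\langle L\rangle$ is defined recursively by $\mathbf{1}\diamond_0 w=w\diamond_0\mathbf{1}=w$; $yu\diamond_0 v=u\diamond_0 yv=y(u\diamond_0 v)$; $du\diamond_0 dv=d(u\diamond_0 dv)-u\diamond_0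 d^2v$; $\langle Y\rangle_{\mathbb{Q}}$ is closed under $\diamond_0$. $\mathcal{L}_-$ is the two-sided ideal of $(\mathbb{Q}\langle L\rangle,\diamond_0)$ generated by $d^k(d(u\diamond_0 v)-du\diamond_0 v-u\diamond_0 dv)$, $k\in\mathbb{N}_0$, $u,v\in L^*$. $\mathcal{H}_0=\mathbb{Q}\langle L\rangle/(\mathcal{L}_-+\mathcal{T}_-)$ is a commutative Hopf algebra, connected graded by depth, with product induced by $\diamond_0$ and coproduct $\Delta_0$ induced by the concatenation morphism with $y\mapsto\mathbf{1}\otimes y+y\otimes\mathbf{1}$, $d\mapsto\mathbf{1}\otimes d+d\otimes\mathbf{1}$. With $x(z)=\frac{e^z}{1-e^z}$, the character $\phi:\mathcal{H}_0\to\mathcal{A}$ is $\phi(\mathbf{1})=1$, $\phi(d^{k_1}y\cdots d^{k_n}y)(z)=\partial_z^{k_1}[x\,\partial_z^{k_2}[x\cdots\partial_z^{k_n}[x]\cdots]](z)$, and $\zeta_+(-k_1,\dots,-k_n):=\lim_{z\to0}\phi_+(d^{k_1}y\cdots d^{k_n}y)(z)$. $q$-side: the bilinear product $\diamond_{-1}$ on $\mathbb{Q}\langle L\rangle$ is defined by $\mathbf{1}\diamond_{-1}w=w\diamond_{-1}\mathbf{1}=w$; $yu\diamond_{-1}v=u\diamond_{-1}yv=y(u\diamond_{-1}v)$; $du\diamond_{-1}dv=du\diamond_{-1}v+u\diamond_{-1}dv-d(u\diamond_{-1}v)$. $\mathcal{H}_{-1}=\mathbb{Q}\langle L\rangle/\mathcal{T}_-\cong\langle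 Y\rangle_{\mathbb{Q}}$ is a Hopf algebra, connected graded by depth, with product induced by $\diamond_{-1}$ and coproduct $\Delta_{-1}$ induced by the concatenation morphism with $y\mapsto\mathbf{1}\otimes y+y\otimes\mathbf{1}$, $d\mapsto\mathbf{1}\otimes d+d\otimes\mathbf{1}-d\otimes d$. The character $\psi:\mathcal{H}_{-1}\to\mathcal{A}$ is given by $\psi(\mathbf{1})=1$ and $$\psi(d^{k_1}y\cdots d^{k_n}y)(z)=\sum_{m_1,\dots,m_n\ge0}\frac{B_{m_1}}{m_1!}\cdots\frac{B_{m_n}}{m_n!}\,C^{k_1,\dots,k_n}_{m_1,\dots,m_n}\,z^{m_1+\cdots+m_n-n},$$ $$C^{k_1,\dots,k_n}_{m_1,\dots,m_n}=\sum_{l_1=0}^{k_1}\cdots\sum_{l_n=0}^{k_n}\prod_{i=1}^n\binom{k_i}{l_i}(-1)^{l_i+1}(l_1+\cdots+l_i+1)^{m_i-1},$$ with Bernoulli numbers $\frac{te^t}{e^t-1}=\sum_{m\ge0}\frac{B_m}{m!}t^m$ (so $B_1=\frac12$). $\psi_+$ is the corresponding Birkhoff factor. *)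

theory Defs
  imports
    "HOL-Library.Poly_Mapping"
    "HOL-Library.Product_Plus"
    "HOL-Computational_Algebra.Formal_Laurent_Series"
begin

section \<open>Words, the free algebra and its tensor square\<close>

datatype letter = D | Y

type_synonym word = "letter list"

text \<open>
  Lists are the free monoid, written additively because the exponents of a
  finitely supported function \<open>'k \<Rightarrow>\<^sub>0 rat\<close> are.  The multiplication of
  \<open>word \<Rightarrow>\<^sub>0 rat\<close> is then the bilinear extension of concatenation, and the
  multiplication of \<open>(word \<times> word) \<Rightarrow>\<^sub>0 rat\<close> is that of the tensor square, the basis
  vector indexed by \<open>(u, v)\<close> being the tensor of \<open>u\<close> and \<open>v\<close>.
\<close>

instantiation list :: (type) monoid_add
begin

definition zero_list_def: "0 = []"
definition plus_list_def: "xs + ys = xs @ ys"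

instance
  by standard (simp_all add: zero_list_def plus_list_def)

end

type_synonym free_alg = "word \<Rightarrow>\<^sub>0 rat"
type_synonym free_alg2 = "(word \<times> word) \<Rightarrow>\<^sub>0 rat"

abbreviation basis :: "'k \<Rightarrow> ('k \<Rightarrow>\<^sub>0 rat)" where
  "basis k \<equiv> Poly_Mapping.single k 1"

definition qscale :: "rat \<Rightarrow> ('k::monoid_add \<Rightarrow>\<^sub>0 rat) \<Rightarrow> ('k \<Rightarrow>\<^sub>0 rat)" where
  "qscale c p = Poly_Mapping.single 0 c * p"

interpretation qv: vector_space qscale
proof
  fix a b :: rat and x y :: "'k::monoid_add \<Rightarrow>\<^sub>0 rat"
  show "qscale a (x + y) = qscale a x + qscale a y"
    by (simp add: qscale_def algebra_simps)
  show "qscale (a + b) x = qscale a x + qscale b x"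
    by (simp add: qscale_def algebra_simps single_add)
  show "qscale a (qscale b x) = qscale (a * b) x"
    by (simp add: qscale_def mult.assoc[symmetric] mult_single)
  show "qscale 1 x = x"
    by (simp add: qscale_def)
qed

definition bilin :: "(word \<Rightarrow> word \<Rightarrow> free_alg) \<Rightarrow> free_alg \<Rightarrow> free_alg \<Rightarrow> free_alg" where
  "bilin m p q = (\<Sum>u\<in>Poly_Mapping.keys p. \<Sum>v\<in>Poly_Mapping.keys q. qscale (Poly_Mapping.lookup p u * Poly_Mapping.lookup q v) (m u v))"

definition T_minus :: "free_alg set" where
  "T_minus = qv.span {basis (w @ [D]) | w. True}"

definition Ywords :: "word set" where
  "Ywords = {w @ [Y] | w. True} \<union> {[]}"

text \<open>The word \<open>d\<^sup>k\<^sup>1 y \<dots> d\<^sup>k\<^sup>n y\<close>.\<close>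

definition yword :: "nat list \<Rightarrow> word" where
  "yword ks = concat (map (\<lambda>k. replicate k D @ [Y]) ks)"

lemma range_yword: "range yword = Ywords"
proof (intro equalityI subsetI)
  fix w assume "w \<in> range yword"
  then obtain ks where "w = yword ks" by blast
  then show "w \<in> Ywords"
    by (cases ks rule: rev_cases) (auto simp: yword_def Ywords_def)
next
  have key: "yword (case ks of [] \<Rightarrow> [] | k # js \<Rightarrow> Suc k # js) = D # yword ks"
    if "ks \<noteq> []" for ks
    using that by (cases ks) (auto simp: yword_def)
  have "w @ [Y] \<in> yword ` (UNIV - {[]})" for w
  proof (induction w)
    case Nil
    have "[Y] = yword [0]" by (simp add: yword_def)
    then show ?case by auto
  next
    case (Cons a w)
    then obtain ks where ks: "ks \<noteq> []" "w @ [Y] = yword ks" by auto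
    show ?case
    proof (cases a)
      case D
      then have "(a # w) @ [Y] = yword (case ks of [] \<Rightarrow> [] | k # js \<Rightarrow> Suc k # js)"
        using key[of ks] ks by simp
      then show ?thesis using ks by (auto split: list.splits)
    next
      case Y
      then have "(a # w) @ [Y] = yword (0 # ks)" using ks by (simp add: yword_def)
      then show ?thesis by blast
    qed
  qed
  moreover have "[] = yword []" by (simp add: yword_def)
  moreover fix w assume "w \<in> Ywords"
  ultimately show "w \<in> range yword" by (auto simp: Ywords_def)
qed

lemma inj_yword: "inj yword"
proof (rule injI)
  have rep: "i = j \<and> u = v"
    if "replicate i D @ Y # u = replicate j D @ Y # v" for i j u v
    using that
  proof (induction i arbitrary: j)
    case 0
    then show ?case by (cases j) auto
  next
    case (Suc i)
    then show ?case by (cases j) auto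
  qed
  fix ks ls assume "yword ks = yword ls"
  then show "ks = ls"
  proof (induction ks arbitrary: ls)
    case Nil
    then show ?case by (cases ls) (auto simp: yword_def)
  next
    case (Cons k ks)
    then obtain l ls' where ls: "ls = l # ls'" by (cases ls) (auto simp: yword_def)
    have "replicate k D @ Y # yword ks = replicate l D @ Y # yword ls'"
      using Cons.prems by (simp add: yword_def ls)
    from rep[OF this] Cons.IH[of ls'] ls show ?case by simp
  qed
qed


section \<open>The two products and coproducts\<close>

fun dia0 :: "word \<Rightarrow> word \<Rightarrow> free_alg" where
  "dia0 [] v = basis v"
| "dia0 (Y # u) v = basis [Y] * dia0 u v"
| "dia0 (D # u) [] = basis (D # u)"
| "dia0 (D # u) (Y # v) = basis [Y] * dia0 (D # u) v"
| "dia0 (D # u) (D # v) = basis [D] * dia0 u (D # v) - dia0 u (D # D # v)"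

fun dia_m1 :: "word \<Rightarrow> word \<Rightarrow> free_alg" where
  "dia_m1 [] v = basis v"
| "dia_m1 (Y # u) v = basis [Y] * dia_m1 u v"
| "dia_m1 (D # u) [] = basis (D # u)"
| "dia_m1 (D # u) (Y # v) = basis [Y] * dia_m1 (D # u) v"
| "dia_m1 (D # u) (D # v) = dia_m1 (D # u) v + dia_m1 u (D # v) - basis [D] * dia_m1 u v"

text \<open>The symmetric clauses hidden by the pattern matching order hold as well.\<close>

lemma basis_mult_basis: "basis u * basis v = basis (u @ v :: word)"
  by (simp add: mult_single plus_list_def)

lemma dia0_Nil_right: "dia0 u [] = basis u"
proof (induction u)
  case (Cons a u)
  then show ?case by (cases a) (auto simp: basis_mult_basis)
qed simp

lemma dia0_Y_right: "dia0 u (Y # v) = basis [Y] * dia0 u v"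
proof (induction u)
  case (Cons a u)
  then show ?case by (cases a) auto
qed (simp add: basis_mult_basis)

text \<open>The span of \<open>Ywords\<close> is closed under \<open>dia0\<close>.\<close>

lemma keys_basis_mult: "Poly_Mapping.keys (basis [a] * p) \<subseteq> (#) a ` Poly_Mapping.keys (p :: free_alg)"
  using keys_mult[of "basis [a]" p] by (auto simp: plus_list_def)

lemma keys_dia0_aux:
  assumes "u \<in> Ywords" "v \<in> Ywords" "u \<noteq> [] \<or> v \<noteq> []"
  shows "Poly_Mapping.keys (dia0 u v) \<subseteq> Ywords - {[]}"
proof -
  have Cons_Y: "a # w \<in> Ywords \<longleftrightarrow> w \<in> Ywords \<and> (w = [] \<longrightarrow> a = Y)" for a w
    by (auto simp: Ywords_def Cons_eq_append_conv)
  have step: "Poly_Mapping.keys (basis [a] * p) \<subseteq> Ywords - {[]}"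
    if "Poly_Mapping.keys p \<subseteq> Ywords - {[]}" for a and p :: free_alg
  proof
    fix w assume "w \<in> Poly_Mapping.keys (basis [a] * p)"
    then obtain w' where "w = a # w'" "w' \<in> Poly_Mapping.keys p"
      using keys_basis_mult[of a p] by blast
    with that show "w \<in> Ywords - {[]}" by (auto simp: Cons_Y)
  qed
  show ?thesis
    using assms
  proof (induction u v rule: dia0.induct)
    case (2 u v)
    show ?case
    proof (cases "u = [] \<and> v = []")
      case True
      then show ?thesis by (simp add: basis_mult_basis Cons_Y Ywords_def)
    next
      case False
      then show ?thesis using 2 step by (auto simp: Cons_Y)
    qed
  next
    case (4 u v)
    then show ?case using step by (simp add: Cons_Y)
  next
    case (5 u v)
    have "Poly_Mapping.keys (basis [D] * dia0 u (D # v)) \<subseteq> Ywords - {[]}"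
      using 5 step by (simp add: Cons_Y)
    moreover have "Poly_Mapping.keys (dia0 u (D # D # v)) \<subseteq> Ywords - {[]}"
      using 5 by (simp add: Cons_Y)
    ultimately show ?case
      using keys_diff[of "basis [D] * dia0 u (D # v)" "dia0 u (D # D # v)"] by auto
  qed auto
qed

lemma keys_dia0:
  assumes "u \<in> Ywords" "v \<in> Ywords"
  shows "Poly_Mapping.keys (dia0 u v) \<subseteq> Ywords"
  using keys_dia0_aux[OF assms] assms by (cases "u = [] \<and> v = []") auto

lemma dia_m1_Nil_right: "dia_m1 u [] = basis u"
proof (induction u)
  case (Cons a u)
  then show ?case by (cases a) (auto simp: basis_mult_basis)
qed simp

lemma dia_m1_Y_right: "dia_m1 u (Y # v) = basis [Y] * dia_m1 u v"
proof (induction u)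
  case (Cons a u)
  then show ?case by (cases a) auto
qed (simp add: basis_mult_basis)

fun cop0_letter :: "letter \<Rightarrow> free_alg2" where
  "cop0_letter Y = basis ([], [Y]) + basis ([Y], [])"
| "cop0_letter D = basis ([], [D]) + basis ([D], [])"

definition cop0 :: "word \<Rightarrow> free_alg2" where
  "cop0 w = prod_list (map cop0_letter w)"

fun cop_m1_letter :: "letter \<Rightarrow> free_alg2" where
  "cop_m1_letter Y = basis ([], [Y]) + basis ([Y], [])"
| "cop_m1_letter D = basis ([], [D]) + basis ([D], []) - basis ([D], [D])"

definition cop_m1 :: "word \<Rightarrow> free_alg2" where
  "cop_m1 w = prod_list (map cop_m1_letter w)"

text \<open>Associativity of \<open>dia0\<close> is not presupposed: an ideal absorbs single multiplications from
  either side, and the ideal generated by a set is the smallest one containing it.\<close>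

definition is_ideal :: "(word \<Rightarrow> word \<Rightarrow> free_alg) \<Rightarrow> free_alg set \<Rightarrow> bool" where
  "is_ideal m J \<longleftrightarrow> qv.subspace J \<and> (\<forall>a\<in>J. \<forall>b. bilin m a b \<in> J \<and> bilin m b a \<in> J)"

definition L_minus :: "free_alg set" where
  "L_minus = is_ideal dia0 hull
     {basis (replicate k D) * (basis [D] * dia0 u v - dia0 (D # u) v - dia0 u (D # v)) | k u v. True}"


section \<open>Quotient Hopf algebras and Birkhoff decomposition\<close>

text \<open>
  A Hopf algebra that is a quotient of the free algebra is recorded by the subspace divided out
  and by representatives, on words, of the induced product and coproduct.  A linear map from the
  quotient to Laurent series is a linear map on the free algebra that vanishes on the subspace;
  it is given by its values on words, and \<open>lin\<close> is the linear extension.  Convolution of such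
  maps is computed with the coproduct of the free algebra.  The counit \<open>e\<close> is
  the coefficient of the empty word.
\<close>

record quot_hopf =
  ker :: "free_alg set"
  mul :: "word \<Rightarrow> word \<Rightarrow> free_alg"
  cop :: "word \<Rightarrow> free_alg2"

definition H_0 :: quot_hopf where
  "H_0 = \<lparr>ker = {a + b | a b. a \<in> L_minus \<and> b \<in> T_minus}, mul = dia0, cop = cop0\<rparr>"

definition H_m1 :: quot_hopf where
  "H_m1 = \<lparr>ker = T_minus, mul = dia_m1, cop = cop_m1\<rparr>"

type_synonym laurent = "rat fls"

definition lin :: "(word \<Rightarrow> laurent) \<Rightarrow> free_alg \<Rightarrow> laurent" where
  "lin f p = (\<Sum>w\<in>Poly_Mapping.keys p. fls_const (Poly_Mapping.lookup p w) * f w)"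

definition quot_map :: "quot_hopf \<Rightarrow> (word \<Rightarrow> laurent) \<Rightarrow> bool" where
  "quot_map H f \<longleftrightarrow> (\<forall>p\<in>ker H. lin f p = 0)"

definition conv :: "quot_hopf \<Rightarrow> (word \<Rightarrow> laurent) \<Rightarrow> (word \<Rightarrow> laurent) \<Rightarrow> word \<Rightarrow> laurent" where
  "conv H f g w = (\<Sum>(u, v)\<in>Poly_Mapping.keys (cop H w). fls_const (Poly_Mapping.lookup (cop H w) (u, v)) * (f u * g v))"

definition counit :: "word \<Rightarrow> laurent" where
  "counit w = (if w = [] then 1 else 0)"

definition character :: "quot_hopf \<Rightarrow> (word \<Rightarrow> laurent) \<Rightarrow> bool" where
  "character H f \<longleftrightarrow>
     quot_map H f \<and> f [] = 1 \<and> (\<forall>u v. lin f (mul H u v) = f u * f v)"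

definition conv_inverse :: "quot_hopf \<Rightarrow> (word \<Rightarrow> laurent) \<Rightarrow> (word \<Rightarrow> laurent) \<Rightarrow> bool" where
  "conv_inverse H f g \<longleftrightarrow> quot_map H g \<and> conv H f g = counit \<and> conv H g f = counit"

definition A_plus :: "laurent set" where
  "A_plus = range fps_to_fls"

definition A_minus :: "laurent set" where
  "A_minus = {f. fls_regpart f = 0}"

definition pole_part :: "laurent \<Rightarrow> laurent" where
  "pole_part f = f - fps_to_fls (fls_regpart f)"

definition birkhoff ::
  "quot_hopf \<Rightarrow> (word \<Rightarrow> laurent) \<Rightarrow> (word \<Rightarrow> laurent) \<Rightarrow> (word \<Rightarrow> laurent) \<Rightarrow> bool" where
  "birkhoff H \<chi> \<chi>m \<chi>p \<longleftrightarrow>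
     character H \<chi>m \<and> range \<chi>m \<subseteq> {fls_const c + a | c a. a \<in> A_minus} \<and>
     character H \<chi>p \<and> range \<chi>p \<subseteq> A_plus \<and>
     (\<exists>\<chi>m_inv. conv_inverse H \<chi>m \<chi>m_inv \<and> \<chi> = conv H \<chi>m_inv \<chi>p) \<and>
     \<chi>m = (\<lambda>w. counit w - pole_part (conv H \<chi>m (\<lambda>v. \<chi> v - counit v) w)) \<and>
     \<chi>p = (\<lambda>w. counit w + (conv H \<chi>m (\<lambda>v. \<chi> v - counit v) w
                 - pole_part (conv H \<chi>m (\<lambda>v. \<chi> v - counit v) w)))"

definition birkhoff_plus :: "quot_hopf \<Rightarrow> (word \<Rightarrow> laurent) \<Rightarrow> word \<Rightarrow> laurent" where
  "birkhoff_plus H \<chi> = (THE \<chi>p. \<exists>\<chi>m. birkhoff H \<chi> \<chi>m \<chi>p)"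

text \<open>The limit at \<open>z = 0\<close> of a formal Laurent series exists iff the series has no pole.\<close>

definition has_limit0 :: "laurent \<Rightarrow> rat \<Rightarrow> bool" where
  "has_limit0 f c \<longleftrightarrow> f \<in> A_plus \<and> fls_nth f 0 = c"

definition limit0 :: "laurent \<Rightarrow> rat" where
  "limit0 f = (THE c. has_limit0 f c)"


section \<open>The two characters and the renormalized values\<close>

definition x_series :: laurent where
  "x_series = fps_to_fls (fps_exp 1) / (1 - fps_to_fls (fps_exp 1))"

text \<open>Words ending in \<open>d\<close> are sent to 0, since the derivative of 1 vanishes.\<close>

fun phi :: "word \<Rightarrow> laurent" where
  "phi [] = 1"
| "phi (D # w) = fls_deriv (phi w)"
| "phi (Y # w) = x_series * phi w"

definition phi_plus :: "word \<Rightarrow> laurent" where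
  "phi_plus = birkhoff_plus H_0 phi"

definition zeta_plus :: "nat list \<Rightarrow> rat" where
  "zeta_plus ks = limit0 (phi_plus (yword ks))"

definition Bern :: "nat \<Rightarrow> rat" where
  "Bern m = fact m * fps_nth (fps_X * fps_exp 1 / (fps_exp 1 - 1)) m"

definition C_coeff :: "nat list \<Rightarrow> nat list \<Rightarrow> rat" where
  "C_coeff ks ms =
     (\<Sum>ls\<in>listset (map (\<lambda>k. {0..k}) ks). \<Prod>i<length ks.
        of_nat (ks ! i choose ls ! i) * (- 1) ^ (ls ! i + 1) *
        of_nat (sum_list (take (Suc i) ls) + 1) powi (int (ms ! i) - 1))"

text \<open>The sum over all \<open>m\<^sub>1, \<dots>, m\<^sub>n\<close> is grouped by the total \<open>m\<^sub>1 + \<dots> + m\<^sub>n\<close>.\<close>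

definition psi_series :: "nat list \<Rightarrow> laurent" where
  "psi_series ks =
     fps_to_fls (Abs_fps (\<lambda>M. \<Sum>ms | length ms = length ks \<and> sum_list ms = M.
       (\<Prod>i<length ks. Bern (ms ! i) / fact (ms ! i)) * C_coeff ks ms)) / fls_X ^ length ks"

definition psi :: "word \<Rightarrow> laurent" where
  "psi w = (if w \<in> Ywords then psi_series (inv yword w) else 0)"

definition psi_plus :: "word \<Rightarrow> laurent" where
  "psi_plus = birkhoff_plus H_m1 psi"

definition z_fun :: "nat list \<Rightarrow> laurent" where
  "z_fun ks = (- 1) ^ sum_list ks / fls_X ^ sum_list ks * psi_plus (yword ks)"

definition z_plus :: "nat list \<Rightarrow> rat" where
  "z_plus ks = limit0 (z_fun ks)"

text \<open>The linear extension is only meaningful on the span of \<open>Ywords\<close>.\<close>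

definition z_plus_word :: "word \<Rightarrow> rat" where
  "z_plus_word w = (if w = [] then 1 else z_plus (inv yword w))"

definition z_plus_lin :: "free_alg \<Rightarrow> rat" where
  "z_plus_lin p = (\<Sum>w\<in>Poly_Mapping.keys p. Poly_Mapping.lookup p w * z_plus_word w)"

end

theory Submission
  imports Defs
begin

text \<open>
  Both characters evaluate words as operators applied to the constant 1.  On the classical side
  \<open>d\<close> acts as \<open>\<partial>\<^sub>z\<close> and \<open>y\<close> as multiplication by \<open>x(z)\<close>; this is
  \<open>deriv_word x\<close>.  On the \<open>q\<close>-side, the numbers \<open>l\<^sub>1 + \<dots> + l\<^sub>i + 1\<close> in the coefficients
  \<open>C\<close> record shifts of an integer variable \<open>a\<close> that starts at 1: \<open>psi w\<close> is the value at
  \<open>a = 1\<close> of the word acting on functions of \<open>a\<close>, with \<open>d\<close> acting as \<open>1 - E\<close>, where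
  \<open>E h (a) = h (a + 1)\<close>, and \<open>y\<close> as multiplication by \<open>x(a z)\<close>
  (\<open>psi_eq_diff_word\<close>).

  Replace \<open>x\<close> by an arbitrary multiplier \<open>f\<close>.  Leibniz rules, of weight 0 for
  \<open>\<partial>\<^sub>z\<close> and of weight \<open>-1\<close> for \<open>1 - E\<close>, show that the resulting maps are characters
  and that convolution adds the multipliers (\<open>deriv_word_conv\<close>, \<open>diff_word_conv\<close>).  Hence the
  splitting \<open>x(z) = - 1/z + x\<^sub>r(z)\<close> into polar and regular part is already the Birkhoff
  decomposition: the polar factor has multiplier \<open>1/z\<close> (respectively \<open>1/(a z)\<close>), the
  regular factor has multiplier \<open>x\<^sub>r(z)\<close> (respectively \<open>x\<^sub>r(a z)\<close>).

  It remains to compare the two regular factors.  In the variable \<open>s = a z\<close> the shift is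
  \<open>exp (z \<partial>\<^sub>s)\<close>, so \<open>- (1 - E) / z\<close> tends to \<open>\<partial>\<^sub>s\<close> as \<open>z\<close> tends to 0.  After division by
  \<open>(- z)\<^sup>k\<close>, with \<open>k\<close> the number of letters \<open>d\<close>, the \<open>q\<close>-value at \<open>s = z\<close> therefore
  tends to the classical value at 0 (\<open>diff_word_leading_term\<close>, \<open>diff_word_limit\<close>).
  Compatibility with \<open>\<diamond>\<^sub>0\<close> follows, since the common value is the constant term
  of a character of \<open>\<diamond>\<^sub>0\<close> with values in power series.
\<close>

section \<open>Linear extension from basis elements\<close>

text \<open>
  One notion of linear extension for the free algebra and for its tensor square, so that applying a
  linear map and convolving two of them become instances of the same function.
\<close>

definition linext :: "('k::monoid_add \<Rightarrow> laurent) \<Rightarrow> ('k \<Rightarrow>\<^sub>0 rat) \<Rightarrow> laurent" where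
  "linext F p = (\<Sum>k\<in>Poly_Mapping.keys p. fls_const (Poly_Mapping.lookup p k) * F k)"

lemma lin_eq_linext: "lin f = linext f"
  by (simp add: lin_def linext_def fun_eq_iff)

lemma conv_eq_linext: "conv H f g w = linext (\<lambda>(u, v). f u * g v) (cop H w)"
  unfolding conv_def linext_def by (rule sum.cong) auto

lemma linext_superset:
  assumes "finite S" "Poly_Mapping.keys p \<subseteq> S"
  shows "linext F p = (\<Sum>k\<in>S. fls_const (Poly_Mapping.lookup p k) * F k)"
  unfolding linext_def using assms
  by (intro sum.mono_neutral_left) (auto simp: in_keys_iff)

lemma linext_zero [simp]: "linext F 0 = 0"
  by (simp add: linext_def)

lemma linext_add [simp]: "linext F (p + q) = linext F p + linext F q"
proof -
  let ?S = "Poly_Mapping.keys p \<union> Poly_Mapping.keys q"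
  have "linext F (p + q) = (\<Sum>k\<in>?S. fls_const (Poly_Mapping.lookup (p + q) k) * F k)"
    using keys_add[of p q] by (intro linext_superset) auto
  also have "\<dots> = (\<Sum>k\<in>?S. fls_const (Poly_Mapping.lookup p k) * F k)
      + (\<Sum>k\<in>?S. fls_const (Poly_Mapping.lookup q k) * F k)"
    by (simp add: lookup_add algebra_simps sum.distrib flip: fls_plus_const)
  also have "\<dots> = linext F p + linext F q"
    by (simp add: linext_superset[of ?S])
  finally show ?thesis .
qed

lemma linext_diff [simp]: "linext F (p - q) = linext F p - linext F q"
  using linext_add[of F "p - q" q] by (simp add: algebra_simps)

lemma linext_sum: "linext F (sum p S) = (\<Sum>i\<in>S. linext F (p i))"
  by (induction S rule: infinite_finite_induct) auto

lemma linext_single [simp]: "linext F (Poly_Mapping.single k c) = fls_const c * F k"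
  by (auto simp: linext_def)

lemma linext_fun_add: "linext (\<lambda>k. F k + G k) p = linext F p + linext G p"
  by (simp add: linext_def algebra_simps sum.distrib)

lemma linext_fun_diff: "linext (\<lambda>k. F k - G k) p = linext F p - linext G p"
  by (simp add: linext_def algebra_simps sum_subtractf)

lemma linext_fun_mult: "linext (\<lambda>k. c * F k) p = c * linext F p"
  by (simp add: linext_def algebra_simps sum_distrib_left)

lemma linext_fun_deriv: "linext (\<lambda>k. fls_deriv (F k)) p = fls_deriv (linext F p)"
  by (simp add: linext_def fls_deriv_sum)

lemma poly_mapping_as_sum:
  "p = (\<Sum>k\<in>Poly_Mapping.keys p. Poly_Mapping.single k (Poly_Mapping.lookup p k))"
  by (rule poly_mapping_eqI) (auto simp: lookup_sum lookup_single when_def in_keys_iff)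

text \<open>
  Left multiplication by a basis element only shifts the argument of the map.  This turns the
  recursions for the products and the coproducts into recursions for the maps applied to them.
\<close>

lemma linext_single_mult:
  "linext F (Poly_Mapping.single k c * p) = fls_const c * linext (\<lambda>j. F (k + j)) p"
proof -
  have "linext F (Poly_Mapping.single k c * p) =
     linext F (\<Sum>j\<in>Poly_Mapping.keys p. Poly_Mapping.single (k + j) (c * Poly_Mapping.lookup p j))"
    by (subst poly_mapping_as_sum[of p], subst sum_distrib_left) (simp add: mult_single)
  also have "\<dots> = fls_const c * linext (\<lambda>j. F (k + j)) p"
    by (simp add: linext_sum linext_def[of "\<lambda>j. F (k + j)"] sum_distrib_left mult.assoc
        flip: fls_const_mult_const)
  finally show ?thesis .
qed

lemma linext_basis_word_mult [simp]: "linext F (basis [a] * p) = linext (\<lambda>w. F (a # w)) p"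
  by (simp add: linext_single_mult plus_list_def)

lemma linext_basis_pair_mult [simp]:
  "linext F (basis (u0, v0) * p) = linext (\<lambda>(u, v). F (u0 @ u, v0 @ v)) p" for u0 v0 :: word
  by (simp add: linext_single_mult plus_list_def plus_prod_def) (simp add: split_def)

lemma linext_qscale [simp]: "linext F (qscale c p) = fls_const c * linext F p"
  by (simp add: qscale_def linext_single_mult)

text \<open>
  The reason why the kernel of a map that is multiplicative on words is an ideal.
\<close>

lemma linext_bilin:
  assumes "\<And>u v. linext f (m u v) = f u * f v"
  shows "linext f (bilin m p q) = linext f p * linext f q"
  unfolding bilin_def
  by (simp add: linext_sum assms) (simp add: linext_def sum_product mult_ac flip: fls_const_mult_const)

lemma subspace_linext_kernel: "qv.subspace {p. linext F p = 0}"
  by (auto simp: qv.subspace_def)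

lemma linext_T_minus:
  assumes "\<And>w. f (w @ [D]) = 0" "p \<in> T_minus"
  shows "linext f p = 0"
proof -
  have "T_minus \<subseteq> {p. linext f p = 0}"
    unfolding T_minus_def using assms(1) by (intro qv.span_minimal subspace_linext_kernel) auto
  then show ?thesis using assms(2) by auto
qed

section \<open>Words as operators\<close>

text \<open>
  The two families of maps that carry the proof.  A word acts on the constant 1, letter by letter
  from the right: \<open>Y\<close> multiplies by \<open>f\<close>, and \<open>D\<close> differentiates
  in the first family and is \<open>1 - E\<close> in the second, where \<open>E\<close> is the shift
  \<open>h(a) \<mapsto> h(a + 1)\<close>.  The letter \<open>y\<close> enters only through \<open>f\<close>, which stays
  arbitrary because the Birkhoff factors arise by changing \<open>f\<close> alone.
\<close>

fun deriv_word :: "laurent \<Rightarrow> word \<Rightarrow> laurent" where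
  "deriv_word f [] = 1"
| "deriv_word f (D # w) = fls_deriv (deriv_word f w)"
| "deriv_word f (Y # w) = f * deriv_word f w"

fun diff_word :: "(nat \<Rightarrow> 'a::comm_ring_1) \<Rightarrow> word \<Rightarrow> nat \<Rightarrow> 'a" where
  "diff_word f [] a = 1"
| "diff_word f (D # w) a = diff_word f w a - diff_word f w (Suc a)"
| "diff_word f (Y # w) a = f a * diff_word f w a"

lemma phi_eq_deriv_word: "phi w = deriv_word x_series w"
  by (induction w rule: phi.induct) auto

lemma deriv_word_append_D: "deriv_word f (w @ [D]) = 0"
proof (induction w)
  case (Cons a w) then show ?case by (cases a) auto
qed simp

lemma diff_word_append_D: "diff_word f (w @ [D]) a = 0"
proof (induction w arbitrary: a)
  case (Cons l w) then show ?case by (cases l) auto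
qed simp

text \<open>
  The recursion of \<open>\<diamond>\<^sub>0\<close> is the Leibniz rule read as
  \<open>U' V' = (U V')' - U V''\<close>.
\<close>

lemma deriv_word_dia0: "linext (deriv_word f) (dia0 u v) = deriv_word f u * deriv_word f v"
  by (induction u v rule: dia0.induct)
     (simp_all add: linext_fun_deriv linext_fun_mult algebra_simps)

text \<open>
  The operator \<open>1 - E\<close> satisfies the Leibniz rule of weight \<open>-1\<close>,
  \<open>U' V' = U' V + U V' - (U V)'\<close>, because \<open>E\<close> is multiplicative.
\<close>

lemma diff_word_dia_m1:
  "linext (\<lambda>w. diff_word f w a) (dia_m1 u v) = diff_word f u a * diff_word f v a"
proof (induction u v arbitrary: a rule: dia_m1.induct)
  case (4 u v)
  then show ?case by (simp add: linext_fun_mult mult.left_commute)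
next
  case (5 u v)
  show ?case by (simp add: 5 linext_fun_diff algebra_simps)
qed (simp_all add: linext_fun_mult algebra_simps)

text \<open>
  The letter \<open>d\<close> is primitive and so acts on a product of two values as the
  derivation that it is, while \<open>y\<close> acts as multiplication by \<open>f\<close> on the first factor plus
  multiplication by \<open>g\<close> on the second.  Convolution thus becomes addition of the multipliers.
\<close>

lemma deriv_word_conv: "conv H_0 (deriv_word f) (deriv_word g) w = deriv_word (f + g) w"
proof (induction w)
  case Nil
  then show ?case by (simp add: conv_eq_linext H_0_def cop0_def flip: single_one) (simp add: zero_prod_def zero_list_def)
next
  case (Cons l w)
  let ?F = "\<lambda>(u, v). deriv_word f u * deriv_word g v"
  have IH: "linext ?F (cop0 w) = deriv_word (f + g) w"
    using Cons by (simp add: conv_eq_linext H_0_def)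
  show ?case
  proof (cases l)
    case D
    have "linext ?F (cop0 (D # w)) = linext (\<lambda>p. fls_deriv (?F p)) (cop0 w)"
      by (simp add: cop0_def distrib_right case_prod_beta flip: linext_fun_add)
    then show ?thesis using D IH by (simp add: conv_eq_linext H_0_def linext_fun_deriv)
  next
    case Y
    have "linext ?F (cop0 (Y # w)) = linext (\<lambda>p. (f + g) * ?F p) (cop0 w)"
      by (simp add: cop0_def distrib_right case_prod_beta flip: linext_fun_add)
         (simp add: algebra_simps)
    then show ?thesis using Y IH by (simp add: conv_eq_linext H_0_def linext_fun_mult)
  qed
qed

text \<open>
  Same reason as for \<open>deriv_word\<close>, the term \<open>- d \<otimes> d\<close> of the coproduct being the
  correction in the weight \<open>-1\<close> Leibniz rule.  The induction needs all \<open>a\<close> at once since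
  \<open>D\<close> moves the point of evaluation.
\<close>

lemma diff_word_conv:
  "conv H_m1 (\<lambda>w. diff_word f w a) (\<lambda>w. diff_word g w a) w = diff_word (\<lambda>b. f b + g b) w a"
proof (induction w arbitrary: a)
  case Nil
  then show ?case by (simp add: conv_eq_linext H_m1_def cop_m1_def flip: single_one) (simp add: zero_prod_def zero_list_def)
next
  case (Cons l w)
  let ?F = "\<lambda>a (u, v). diff_word f u a * diff_word g v a"
  have IH: "linext (?F a) (cop_m1 w) = diff_word (\<lambda>b. f b + g b) w a" for a
    using Cons by (simp add: conv_eq_linext H_m1_def)
  show ?case
  proof (cases l)
    case D
    have "linext (?F a) (cop_m1 (D # w)) = linext (\<lambda>p. ?F a p - ?F (Suc a) p) (cop_m1 w)"
      by (simp add: cop_m1_def distrib_right left_diff_distrib case_prod_beta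
          flip: linext_fun_add linext_fun_diff) (simp add: algebra_simps)
    then show ?thesis using D IH by (simp add: conv_eq_linext H_m1_def linext_fun_diff)
  next
    case Y
    have "linext (?F a) (cop_m1 (Y # w)) = linext (\<lambda>p. (f a + g a) * ?F a p) (cop_m1 w)"
      by (simp add: cop_m1_def distrib_right case_prod_beta flip: linext_fun_add)
         (simp add: algebra_simps)
    then show ?thesis using Y IH by (simp add: conv_eq_linext H_m1_def linext_fun_mult)
  qed
qed

text \<open>
  The kernel of \<open>deriv_word f\<close> is an ideal for \<open>\<diamond>\<^sub>0\<close>, and it contains the generators
  of \<open>\<L>\<^sub>-\<close> since these are derivatives of the defect in the Leibniz rule.
\<close>

lemma deriv_word_L_minus:
  assumes "p \<in> L_minus"
  shows "linext (deriv_word f) p = 0"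
proof -
  let ?K = "{p. linext (deriv_word f) p = 0}"
  have "linext (deriv_word f) (basis (replicate k D) * p) = 0"
    if "linext (deriv_word f) p = 0" for k and p :: free_alg
  proof (induction k)
    case 0
    then show ?case using that by (simp add: flip: zero_list_def)
  next
    case (Suc k)
    have "basis (replicate (Suc k) D) * p = basis [D] * (basis (replicate k D) * p)"
      by (simp add: basis_mult_basis flip: mult.assoc)
    with Suc show ?case by (simp add: linext_fun_deriv)
  qed
  moreover have "linext (deriv_word f) (basis [D] * dia0 u v - dia0 (D # u) v - dia0 u (D # v)) = 0" for u v
    by (simp add: deriv_word_dia0 linext_fun_deriv)
  ultimately have gen: "{basis (replicate k D) * (basis [D] * dia0 u v - dia0 (D # u) v - dia0 u (D # v)) | k u v. True} \<subseteq> ?K"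
    by blast
  have "is_ideal dia0 ?K"
    by (simp add: is_ideal_def subspace_linext_kernel linext_bilin deriv_word_dia0)
  with gen have "L_minus \<subseteq> ?K"
    unfolding L_minus_def by (rule hull_minimal)
  with assms show ?thesis by auto
qed

lemma deriv_word_quot_map: "quot_map H_0 (deriv_word f)"
  by (auto simp: quot_map_def H_0_def lin_eq_linext deriv_word_L_minus
      linext_T_minus[where f = "deriv_word f"] deriv_word_append_D)

lemma deriv_word_character: "character H_0 (deriv_word f)"
  by (simp add: character_def deriv_word_quot_map lin_eq_linext) (simp add: H_0_def deriv_word_dia0)

lemma diff_word_quot_map: "quot_map H_m1 (\<lambda>w. diff_word f w a)"
  by (auto simp: quot_map_def H_m1_def lin_eq_linext intro!: linext_T_minus diff_word_append_D)

lemma diff_word_character: "character H_m1 (\<lambda>w. diff_word f w a)"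
  by (simp add: character_def diff_word_quot_map lin_eq_linext) (simp add: H_m1_def diff_word_dia_m1)

text \<open>
  The zero multiplier gives the unit of convolution, so that \<open>- f\<close> gives the convolution inverse
  of what \<open>f\<close> gives.
\<close>

lemma deriv_word_0: "deriv_word 0 = counit"
proof
  show "deriv_word 0 w = counit w" for w
    by (induction w rule: phi.induct) (auto simp: counit_def)
qed

lemma diff_word_0: "(\<lambda>w. diff_word (\<lambda>b. 0) w a) = counit"
proof
  show "diff_word (\<lambda>b. 0) w a = counit w" for w
    by (induction w arbitrary: a rule: phi.induct) (auto simp: counit_def)
qed

section \<open>Recognising the regular Birkhoff factor\<close>

abbreviation depth :: "word \<Rightarrow> nat" where
  "depth w \<equiv> count_list w Y"

lemma depth_keys_prod_list:
  assumes "\<And>l u v. (u, v) \<in> Poly_Mapping.keys (c l) \<Longrightarrow> depth u + depth v = depth [l]"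
    and "(u, v) \<in> Poly_Mapping.keys (prod_list (map c w) :: free_alg2)"
  shows "depth u + depth v = depth w"
  using assms(2)
proof (induction w arbitrary: u v)
  case Nil
  then show ?case by (simp add: zero_prod_def zero_list_def)
next
  case (Cons l w)
  then obtain u1 v1 u2 v2 where "(u1, v1) \<in> Poly_Mapping.keys (c l)"
      "(u2, v2) \<in> Poly_Mapping.keys (prod_list (map c w))" "u = u1 @ u2" "v = v1 @ v2"
    using keys_mult[of "c l" "prod_list (map c w)"] by (fastforce simp: plus_list_def)
  with assms(1) Cons.IH show ?case by fastforce
qed

lemma depth_keys_cop0:
  assumes "(u, v) \<in> Poly_Mapping.keys (cop H_0 w)"
  shows "depth u + depth v = depth w"
proof (rule depth_keys_prod_list[where c = cop0_letter])
  show "depth u + depth v = depth [l]" if "(u, v) \<in> Poly_Mapping.keys (cop0_letter l)" for l u v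
    using that keys_add[of "basis ([], [l])" "basis ([l], [])"] by (cases l) auto
qed (use assms in \<open>simp add: H_0_def cop0_def\<close>)

lemma depth_keys_cop_m1:
  assumes "(u, v) \<in> Poly_Mapping.keys (cop H_m1 w)"
  shows "depth u + depth v = depth w"
proof (rule depth_keys_prod_list[where c = cop_m1_letter])
  show "depth u + depth v = depth [l]" if "(u, v) \<in> Poly_Mapping.keys (cop_m1_letter l)" for l u v
  proof -
    have "Poly_Mapping.keys (cop_m1_letter D) \<subseteq> {([], [D]), ([D], []), ([D], [D])}"
      using keys_add[of "basis ([], [D])" "basis ([D], [])"]
        keys_diff[of "basis ([], [D]) + basis ([D], [])" "basis ([D], [D])"] by auto
    with that show ?thesis
      using keys_add[of "basis ([], [Y])" "basis ([Y], [])"]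
      by (cases l) (auto simp del: cop_m1_letter.simps(2))
  qed
qed (use assms in \<open>simp add: H_m1_def cop_m1_def\<close>)

lemma pole_part_plus: "f \<in> A_plus \<Longrightarrow> pole_part f = 0"
  by (auto simp: A_plus_def pole_part_def)

lemma pole_part_diff: "pole_part (f - g) = pole_part f - pole_part g"
  by (simp add: pole_part_def)

lemma pole_part_minus: "f \<in> A_minus \<Longrightarrow> pole_part f = f"
  by (simp add: A_minus_def pole_part_def)

text \<open>
  The recursion for the polar factor determines it by induction on depth: the right-hand tensor
  factors of depth 0 are killed by \<open>\<chi> - e\<close>, and those that remain leave a left-hand factor of
  strictly smaller depth.
\<close>

lemma birkhoff_minus_unique:
  assumes graded: "\<And>u v w. (u, v) \<in> Poly_Mapping.keys (cop H w) \<Longrightarrow> depth u + depth v = depth w"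
    and depth0: "\<And>v. depth v = 0 \<Longrightarrow> \<chi> v = counit v"
    and f: "f = (\<lambda>w. counit w - pole_part (conv H f (\<lambda>v. \<chi> v - counit v) w))"
    and g: "g = (\<lambda>w. counit w - pole_part (conv H g (\<lambda>v. \<chi> v - counit v) w))"
  shows "f = g"
proof
  fix w show "f w = g w"
  proof (induction w rule: measure_induct_rule[of depth])
    case (less w)
    have "f u * (\<chi> v - counit v) = g u * (\<chi> v - counit v)"
      if "(u, v) \<in> Poly_Mapping.keys (cop H w)" for u v
      using less[of u] graded[OF that] depth0[of v] by (cases "depth v = 0") auto
    then have "conv H f (\<lambda>v. \<chi> v - counit v) w = conv H g (\<lambda>v. \<chi> v - counit v) w"
      unfolding conv_def by (intro sum.cong) auto
    then show ?case by (subst f, subst g) simp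
  qed
qed

text \<open>
  Given a factorisation into characters of which one has only poles off the empty word and the other
  has none, the recursive equations hold automatically:
  \<open>\<chi>\<^sub>- \<star> (\<chi> - e) = \<chi>\<^sub>+ - \<chi>\<^sub>-\<close>, and the pole part of the right-hand side is
  \<open>e - \<chi>\<^sub>-\<close>.  With uniqueness this identifies the regular factor.
\<close>

lemma birkhoff_plus_eqI:
  assumes graded: "\<And>u v w. (u, v) \<in> Poly_Mapping.keys (cop H w) \<Longrightarrow> depth u + depth v = depth w"
    and depth0: "\<And>v. depth v = 0 \<Longrightarrow> \<chi> v = counit v"
    and char: "character H \<chi>m" "character H \<chi>p"
    and minus: "\<And>w. w \<noteq> [] \<Longrightarrow> \<chi>m w \<in> A_minus"
    and plus: "\<And>w. \<chi>p w \<in> A_plus"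
    and inv: "conv_inverse H \<chi>m \<chi>m_inv"
    and dec: "\<chi> = conv H \<chi>m_inv \<chi>p" "\<chi>p = conv H \<chi>m \<chi>" "\<chi>m = conv H \<chi>m counit"
  shows "birkhoff_plus H \<chi> = \<chi>p"
proof -
  have conv: "conv H \<chi>m (\<lambda>v. \<chi> v - counit v) w = \<chi>p w - \<chi>m w" for w
  proof -
    have "conv H \<chi>m (\<lambda>v. \<chi> v - counit v) w = conv H \<chi>m \<chi> w - conv H \<chi>m counit w"
      by (simp add: conv_eq_linext right_diff_distrib split_def flip: linext_fun_diff)
    then show ?thesis by (simp flip: dec(2,3))
  qed
  have Nil: "\<chi>m [] = 1" "\<chi>p [] = 1" using char by (auto simp: character_def)
  have pole: "pole_part (\<chi>p w - \<chi>m w) = counit w - \<chi>m w" for w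
  proof (cases "w = []")
    case True
    then show ?thesis by (simp add: Nil counit_def pole_part_def)
  next
    case False
    then show ?thesis
      using minus plus by (simp add: pole_part_diff pole_part_plus pole_part_minus counit_def)
  qed
  have "\<chi>m w \<in> {fls_const c + a | c a. a \<in> A_minus}" for w
  proof (cases "w = []")
    case True
    have "\<chi>m w = fls_const 1 + 0" using True Nil by simp
    moreover have "(0 :: laurent) \<in> A_minus" by (simp add: A_minus_def)
    ultimately show ?thesis by blast
  next
    case False
    have "\<chi>m w = fls_const 0 + \<chi>m w" by simp
    then show ?thesis using minus[OF False] by blast
  qed
  then have range_minus: "range \<chi>m \<subseteq> {fls_const c + a | c a. a \<in> A_minus}" by blast
  have range_plus: "range \<chi>p \<subseteq> A_plus" using plus by blast
  have ex: "birkhoff H \<chi> \<chi>m \<chi>p"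
    unfolding birkhoff_def conv pole
    using char range_minus range_plus
    by (intro conjI exI[of _ \<chi>m_inv] inv dec(1)) simp_all
  show ?thesis
    unfolding birkhoff_plus_def
  proof (rule the_equality)
    show "\<exists>\<chi>m. birkhoff H \<chi> \<chi>m \<chi>p" using ex by blast
  next
    fix \<chi>p' assume "\<exists>\<chi>m. birkhoff H \<chi> \<chi>m \<chi>p'"
    then obtain \<chi>m' where ex': "birkhoff H \<chi> \<chi>m' \<chi>p'" by blast
    have "\<chi>m' = \<chi>m"
      by (rule birkhoff_minus_unique[OF graded depth0])
        (use ex ex' in \<open>unfold birkhoff_def, blast+\<close>)
    moreover have "\<chi>p' = (\<lambda>w. counit w + (conv H \<chi>m' (\<lambda>v. \<chi> v - counit v) w
        - pole_part (conv H \<chi>m' (\<lambda>v. \<chi> v - counit v) w)))"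
      using ex' unfolding birkhoff_def by blast
    moreover have "\<chi>p = (\<lambda>w. counit w + (conv H \<chi>m (\<lambda>v. \<chi> v - counit v) w
        - pole_part (conv H \<chi>m (\<lambda>v. \<chi> v - counit v) w)))"
      using ex unfolding birkhoff_def by blast
    ultimately show "\<chi>p' = \<chi>p" by (simp only:)
  qed
qed

lemma deriv_word_depth_0: "depth w = 0 \<Longrightarrow> deriv_word f w = counit w"
proof (induction w)
  case (Cons l w)
  then show ?case by (cases l) (auto simp: counit_def)
qed (simp add: counit_def)

lemma diff_word_depth_0: "depth w = 0 \<Longrightarrow> diff_word f w a = counit w"
proof (induction w arbitrary: a)
  case (Cons l w)
  then show ?case by (cases l) (auto simp: counit_def)
qed (simp add: counit_def)

text \<open>
  With multiplier \<open>1/z\<close> both letters lower the exponent by one, so the value of a word is a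
  single monomial.
\<close>

lemma deriv_word_X_inv_nth:
  "n \<noteq> - int (length w) \<Longrightarrow> fls_nth (deriv_word fls_X_inv w) n = 0"
proof (induction w arbitrary: n)
  case (Cons l w)
  then show ?case by (cases l) (auto simp: fls_X_inv_times_conv_shift)
qed simp

lemma diff_word_X_inv_nth:
  "n \<noteq> - int (depth w) \<Longrightarrow> fls_nth (diff_word (\<lambda>b. fls_const (c b) * fls_X_inv) w a) n = 0"
proof (induction w arbitrary: n a)
  case (Cons l w)
  then show ?case by (cases l) (auto simp: fls_X_inv_times_conv_shift(1) mult.assoc)
qed simp

lemma deriv_word_X_inv_pole: "w \<noteq> [] \<Longrightarrow> deriv_word fls_X_inv w \<in> A_minus"
  by (cases w) (auto simp: A_minus_def intro!: fps_ext deriv_word_X_inv_nth)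

lemma diff_word_X_inv_pole:
  assumes "w \<noteq> []"
  shows "diff_word (\<lambda>b. fls_const (c b) * fls_X_inv) w a \<in> A_minus"
proof (cases "depth w = 0")
  case True
  then show ?thesis using assms by (simp add: diff_word_depth_0 counit_def A_minus_def)
next
  case False
  then show ?thesis by (auto simp: A_minus_def intro!: fps_ext diff_word_X_inv_nth)
qed

text \<open>
  Since convolution adds multipliers, splitting the multiplier as \<open>g - 1/z\<close> splits the
  character; the polar factor has multiplier \<open>1/z\<close>.
\<close>

lemma birkhoff_plus_deriv_word:
  assumes plus: "\<And>w. deriv_word g w \<in> A_plus"
  shows "birkhoff_plus H_0 (deriv_word (g - fls_X_inv)) = deriv_word g"
proof (rule birkhoff_plus_eqI[OF depth_keys_cop0 deriv_word_depth_0
      deriv_word_character deriv_word_character deriv_word_X_inv_pole plus])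
  show "conv_inverse H_0 (deriv_word fls_X_inv) (deriv_word (- fls_X_inv))"
    by (simp add: conv_inverse_def deriv_word_quot_map fun_eq_iff deriv_word_conv deriv_word_0)
  show "deriv_word fls_X_inv = conv H_0 (deriv_word fls_X_inv) counit"
    unfolding deriv_word_0[symmetric] by (simp add: fun_eq_iff deriv_word_conv)
qed (simp_all add: fun_eq_iff deriv_word_conv)

text \<open>
  The residue \<open>c\<close> may depend on the point of evaluation, since only the powers of \<open>z\<close>
  matter.
\<close>

lemma birkhoff_plus_diff_word:
  assumes plus: "\<And>w. diff_word g w a \<in> A_plus"
  shows "birkhoff_plus H_m1 (\<lambda>w. diff_word (\<lambda>b. g b - fls_const (c b) * fls_X_inv) w a)
    = (\<lambda>w. diff_word g w a)"
proof (rule birkhoff_plus_eqI[OF depth_keys_cop_m1 diff_word_depth_0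
      diff_word_character diff_word_character diff_word_X_inv_pole plus])
  let ?p = "\<lambda>b. fls_const (c b) * fls_X_inv"
  show "conv_inverse H_m1 (\<lambda>w. diff_word ?p w a) (\<lambda>w. diff_word (\<lambda>b. - ?p b) w a)"
    using diff_word_0[of a]
    by (simp add: conv_inverse_def diff_word_quot_map fun_eq_iff diff_word_conv)
  show "(\<lambda>w. diff_word ?p w a) = conv H_m1 (\<lambda>w. diff_word ?p w a) counit"
    unfolding diff_word_0[of a, symmetric] by (simp add: fun_eq_iff diff_word_conv)
qed (simp_all add: fun_eq_iff diff_word_conv)

section \<open>From differences to derivatives\<close>

text \<open>
  The two leading coefficients of \<open>p(X + 1)\<close>: differencing lowers the degree, and the new leading
  coefficient is the one of the derivative.
\<close>

lemma coeff_pcompose_shift: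
  fixes p :: "rat poly"
  assumes "\<And>j. j > m \<Longrightarrow> coeff p j = 0"
  shows "(\<forall>j>m. coeff (pcompose p [:1, 1:]) j = 0) \<and>
    coeff (pcompose p [:1, 1:]) m = coeff p m \<and>
    (\<forall>i. m = Suc i \<longrightarrow> coeff (pcompose p [:1, 1:]) i = coeff p i + of_nat m * coeff p m)"
  using assms
proof (induction p arbitrary: m)
  case 0
  then show ?case by simp
next
  case (pCons c p)
  let ?r = "pcompose p [:1, 1:]"
  have Suc: "coeff (pcompose (pCons c p) [:1, 1:]) (Suc j) = coeff ?r (Suc j) + coeff ?r j" for j
    by (simp add: pcompose_pCons)
  have zero: "coeff (pcompose (pCons c p) [:1, 1:]) 0 = c + coeff ?r 0"
    by (simp add: pcompose_pCons)
  show ?case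
  proof (cases m)
    case 0
    then have "p = 0" using pCons.prems[of "Suc _"] by (auto intro!: poly_eqI)
    then show ?thesis using 0 by (simp add: coeff_pCons split: nat.splits)
  next
    case m: (Suc m')
    have IH: "(\<forall>j>m'. coeff ?r j = 0)" "coeff ?r m' = coeff p m'"
      "\<And>i. m' = Suc i \<Longrightarrow> coeff ?r i = coeff p i + of_nat m' * coeff p m'"
      using pCons.IH[of m'] pCons.prems[of "Suc _"] m by auto
    show ?thesis
    proof (intro conjI allI impI)
      fix j assume "m < j"
      then show "coeff (pcompose (pCons c p) [:1, 1:]) j = 0"
        using IH(1) m by (cases j) (auto simp: Suc)
    next
      show "coeff (pcompose (pCons c p) [:1, 1:]) m = coeff (pCons c p) m"
        using IH m by (simp add: Suc)
    next
      fix i assume "m = Suc i"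
      then show "coeff (pcompose (pCons c p) [:1, 1:]) i =
          coeff (pCons c p) i + of_nat m * coeff (pCons c p) m"
        using IH m by (cases i) (auto simp: Suc zero algebra_simps)
    qed
  qed
qed

text \<open>
  The heart of the comparison.  Put \<open>s = a z\<close>.  Then \<open>E\<close> is \<open>exp (z \<partial>\<^sub>s)\<close>, so that
  \<open>1 - E = - z \<partial>\<^sub>s + O(z\<^sup>2)\<close>, and a word with \<open>k\<close> letters \<open>D\<close> takes the value
  \<open>(- z)\<^sup>k h(s) + O(z\<^sup>k\<^sup>+\<^sup>1)\<close> for \<open>s\<close> fixed, where \<open>h\<close> is the value for the
  derivation.  Expanded in \<open>z\<close> with \<open>a\<close> kept as a variable, this says that the coefficient
  of \<open>z\<^sup>n\<close> is a polynomial in \<open>a\<close> of degree at most \<open>n - k\<close> in which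
  \<open>a\<^sup>n\<^sup>-\<^sup>k\<close> has coefficient \<open>(- 1)\<^sup>k h\<^sub>n\<^sub>-\<^sub>k\<close>.  Both the degrees and these
  coefficients are needed, as each letter \<open>D\<close> turns the latter into the coefficients of
  \<open>h'\<close>.
\<close>

lemma diff_word_leading_term:
  fixes g :: "rat fps" and w :: word
  shows "\<exists>h p. deriv_word (fps_to_fls g) w = fps_to_fls h \<and>
    (\<forall>a n. fps_nth (diff_word (\<lambda>b. Abs_fps (\<lambda>m. fps_nth g m * of_nat b ^ m)) w a) n
      = poly (p n) (of_nat a)) \<and>
    (\<forall>n j. n < j + count_list w D \<longrightarrow> coeff (p n) j = 0) \<and>
    (\<forall>j. coeff (p (j + count_list w D)) j = (- 1) ^ count_list w D * fps_nth h j)"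
proof (induction w)
  case Nil
  have "fps_nth (1 :: rat fps) n = poly (if n = 0 then 1 else 0) (of_nat a)" for a n
    by simp
  moreover have "coeff (if j = 0 then 1 else 0) j = fps_nth (1 :: rat fps) j" for j
    by simp
  ultimately show ?case
    by (intro exI[of _ 1] exI[of _ "\<lambda>n. if n = 0 then 1 else 0"]) auto
next
  case (Cons l w)
  let ?diff = "diff_word (\<lambda>b. Abs_fps (\<lambda>m. fps_nth g m * of_nat b ^ m))"
  define k where "k = count_list w D"
  from Cons obtain h p where h: "deriv_word (fps_to_fls g) w = fps_to_fls h"
    and p: "\<And>a n. fps_nth (?diff w a) n = poly (p n) (of_nat a)"
    and deg: "\<And>n j. n < j + k \<Longrightarrow> coeff (p n) j = 0"
    and lead: "\<And>j. coeff (p (j + k)) j = (- 1) ^ k * fps_nth h j"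
    unfolding k_def by blast
  show ?case
  proof (cases l)
    case D
    define p' where "p' n = p n - pcompose (p n) [:1, 1:]" for n
    have deg': "coeff (p' n) j = 0" if "n < j + Suc k" for n j
    proof (cases "n < k")
      case True
      then have "p n = 0" using deg by (intro poly_eqI) simp
      then show ?thesis by (simp add: p'_def)
    next
      case False
      then have "\<And>j. j > n - k \<Longrightarrow> coeff (p n) j = 0" using deg by simp
      from coeff_pcompose_shift[OF this] this that False show ?thesis
        by (cases "j = n - k") (auto simp: p'_def)
    qed
    have lead': "coeff (p' (j + Suc k)) j = (- 1) ^ Suc k * fps_nth (fps_deriv h) j" for j
    proof -
      have "\<And>i. i > Suc j \<Longrightarrow> coeff (p (Suc j + k)) i = 0" using deg by simp
      from coeff_pcompose_shift[OF this] lead[of "Suc j"] show ?thesis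
        by (simp add: p'_def algebra_simps)
    qed
    have "fps_nth (?diff (D # w) a) n = poly (p' n) (of_nat a)" for a n
      by (simp add: p p'_def poly_pcompose)
    with D deg' lead' h show ?thesis
      by (intro exI[of _ "fps_deriv h"] exI[of _ p']) (simp add: k_def fls_deriv_fps_to_fls)
  next
    case Y
    define p' where "p' n = (\<Sum>i=0..n. smult (fps_nth g i) (monom 1 i * p (n - i)))" for n
    have coeff: "coeff (p' n) j =
        (\<Sum>i=0..n. fps_nth g i * (if j < i then 0 else coeff (p (n - i)) (j - i)))" for n j
      by (auto simp: p'_def coeff_sum coeff_monom_mult intro!: sum.cong)
    have deg': "coeff (p' n) j = 0" if "n < j + k" for n j
      unfolding coeff using that deg by (intro sum.neutral) auto
    \<comment> \<open>The factor \<open>a\<^sup>i\<close> removes the terms with \<open>i > j\<close>, which leaves the Cauchy product.\<close>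
    have lead': "coeff (p' (j + k)) j = (- 1) ^ k * fps_nth (g * h) j" for j
    proof -
      have "coeff (p' (j + k)) j = (\<Sum>i=0..j. fps_nth g i * coeff (p (j + k - i)) (j - i))"
        unfolding coeff by (rule sum.mono_neutral_cong_right) auto
      also have "\<dots> = (\<Sum>i=0..j. fps_nth g i * ((- 1) ^ k * fps_nth h (j - i)))"
        by (intro sum.cong refl arg_cong2[where f = "(*)"]) (simp flip: lead)
      finally show ?thesis by (simp add: fps_mult_nth sum_distrib_left mult.left_commute)
    qed
    have "fps_nth (?diff (Y # w) a) n = poly (p' n) (of_nat a)" for a n
      by (simp add: fps_mult_nth p p'_def poly_sum poly_monom mult.assoc)
    with Y deg' lead' h show ?thesis
      by (intro exI[of _ "g * h"] exI[of _ p']) (simp add: k_def fls_times_fps_to_fls)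
  qed
qed

text \<open>
  In degree \<open>n = k\<close> the polynomial is constant, so the limit does not depend on \<open>a\<close>; in
  particular \<open>a = 1\<close> may be used on the \<open>q\<close>-side.
\<close>

lemma diff_word_limit:
  fixes g :: "rat fps" and w :: word and a :: nat
  defines "F \<equiv> diff_word (\<lambda>b. Abs_fps (\<lambda>m. fps_nth g m * of_nat b ^ m)) w a"
    and "k \<equiv> count_list w D"
  shows "n < k \<Longrightarrow> fps_nth F n = 0"
    and "fps_nth F k = (- 1) ^ k * fls_nth (deriv_word (fps_to_fls g) w) 0"
proof -
  obtain h p where h: "deriv_word (fps_to_fls g) w = fps_to_fls h"
    and p': "\<And>b n. fps_nth (diff_word (\<lambda>b. Abs_fps (\<lambda>m. fps_nth g m * of_nat b ^ m)) w b) n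
      = poly (p n) (of_nat b)"
    and deg: "\<And>n j. n < j + k \<Longrightarrow> coeff (p n) j = 0"
    and lead: "\<And>j. coeff (p (j + k)) j = (- 1) ^ k * fps_nth h j"
    using diff_word_leading_term[of g w] unfolding k_def by blast
  have p: "fps_nth F n = poly (p n) (of_nat a)" for n
    by (simp add: F_def p')
  show "fps_nth F n = 0" if "n < k"
  proof -
    have "p n = 0" using that deg by (intro poly_eqI) simp
    then show ?thesis by (simp add: p)
  qed
  have "coeff (p k) j = coeff [:(- 1) ^ k * fps_nth h 0:] j" for j
    using deg[of k j] lead[of 0] by (cases j) auto
  then have "p k = [:(- 1) ^ k * fps_nth h 0:]" by (intro poly_eqI)
  then show "fps_nth F k = (- 1) ^ k * fls_nth (deriv_word (fps_to_fls g) w) 0"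
    by (simp add: p h)
qed

lemma deriv_word_regular: "deriv_word (fps_to_fls g) w \<in> A_plus"
proof -
  obtain h where "deriv_word (fps_to_fls g) w = fps_to_fls h"
    using diff_word_leading_term[of g w] by blast
  then show ?thesis by (simp add: A_plus_def)
qed

lemma diff_word_fps_to_fls:
  "diff_word (\<lambda>b. fps_to_fls (f b)) w a = fps_to_fls (diff_word f w a)"
proof (induction w arbitrary: a)
  case (Cons l w)
  then show ?case by (cases l) (auto simp: fls_times_fps_to_fls)
qed simp

section \<open>The function x and the character psi\<close>

definition bern_fps :: "rat fps" where
  "bern_fps = fps_X * fps_exp 1 / (fps_exp 1 - 1)"

lemma Bern_div_fact: "Bern m / fact m = fps_nth bern_fps m"
  by (simp add: Bern_def bern_fps_def)

text \<open>
  The divisor is not a unit; the division is exact because numerator and divisor both have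
  order 1.
\<close>

lemma bern_fps_mult: "bern_fps * (fps_exp 1 - 1) = fps_X * fps_exp 1"
proof -
  have sub: "subdegree (fps_exp 1 - 1 :: rat fps) = 1"
    by (rule subdegreeI) auto
  then have "(fps_exp 1 - 1 :: rat fps) \<noteq> 0" by (metis subdegree_0 zero_neq_one)
  moreover have "(fps_X * fps_exp 1 :: rat fps) \<noteq> 0" by simp
  moreover have "subdegree (fps_X * fps_exp 1 :: rat fps) = 1"
    by (rule subdegreeI) auto
  ultimately have "(fps_exp 1 - 1 :: rat fps) dvd fps_X * fps_exp 1"
    using sub by (simp add: fps_dvd_iff)
  then show ?thesis unfolding bern_fps_def by (rule dvd_div_mult_self)
qed

lemma bern_fps_0: "fps_nth bern_fps 0 = 1"
  using arg_cong[OF bern_fps_mult, of "\<lambda>f. fps_nth f 1"]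
  by (simp add: fps_mult_nth)

text \<open>
  The regular part of \<open>x(z) = e\<^sup>z / (1 - e\<^sup>z)\<close>; the polar part is \<open>- 1/z\<close>.
\<close>

definition x_reg :: "rat fps" where
  "x_reg = Abs_fps (\<lambda>m. - fps_nth bern_fps (Suc m))"

lemma bern_fps_conv_x_reg: "bern_fps = 1 - fps_X * x_reg"
  by (rule fps_ext) (auto simp: x_reg_def bern_fps_0 split: nat.splits)

lemma fls_X_inv_X [simp]: "fls_X_inv * fls_X = (1 :: laurent)"
  by (simp add: fls_X_inv_times_conv_shift(1))

lemma x_series_eq: "x_series = fps_to_fls x_reg - fls_X_inv"
proof -
  let ?E = "fps_to_fls (fps_exp 1) :: laurent"
  have "fps_nth (fps_exp 1 :: rat fps) 1 \<noteq> fps_nth 1 1" by simp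
  then have "(fps_exp 1 :: rat fps) \<noteq> 1" by metis
  then have nz: "1 - ?E \<noteq> 0" by (metis eq_iff_diff_eq_0 fps_to_fls_eq_1_iff)
  have "(fps_to_fls x_reg - fls_X_inv) * (1 - ?E)
      = (fls_X_inv - (fls_X_inv * fls_X) * fps_to_fls x_reg) * (?E - 1)"
    unfolding fls_X_inv_X by (simp add: algebra_simps)
  also have "\<dots> = fls_X_inv * ((1 - fls_X * fps_to_fls x_reg) * (?E - 1))"
    by (simp only: algebra_simps mult_1_left mult_1_right)
  also have "(1 - fls_X * fps_to_fls x_reg) * (?E - 1) = fps_to_fls (bern_fps * (fps_exp 1 - 1))"
    by (simp add: fls_times_fps_to_fls bern_fps_conv_x_reg)
  also have "fls_X_inv * \<dots> = ?E"
    by (simp add: bern_fps_mult fls_times_fps_to_fls flip: mult.assoc)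
  finally show ?thesis unfolding x_series_def using nz by (simp add: field_simps)
qed

text \<open>
  \<open>z x(a z)\<close> and the regular part of \<open>x(a z)\<close>.  The exponent \<open>m - 1\<close> is the one of
  the coefficients \<open>C\<close>; at \<open>a = 0\<close> the term \<open>m = 0\<close> is \<open>0\<close> by the convention
  for division by zero, consistently with \<open>1 / a = 0\<close>.
\<close>

definition bern_scaled :: "nat \<Rightarrow> rat fps" where
  "bern_scaled a = Abs_fps (\<lambda>m. - fps_nth bern_fps m * of_nat a powi (int m - 1))"

definition x_reg_scaled :: "nat \<Rightarrow> rat fps" where
  "x_reg_scaled a = Abs_fps (\<lambda>m. fps_nth x_reg m * of_nat a ^ m)"

lemma bern_scaled_eq:
  "fps_to_fls (bern_scaled a) * fls_X_inv
    = fps_to_fls (x_reg_scaled a) - fls_const (1 / of_nat a) * fls_X_inv"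
proof -
  have eq: "bern_scaled a = fps_X * x_reg_scaled a - fps_const (1 / of_nat a)"
  proof (rule fps_ext)
    fix m
    show "fps_nth (bern_scaled a) m = fps_nth (fps_X * x_reg_scaled a - fps_const (1 / of_nat a)) m"
      by (cases m)
        (simp_all add: bern_scaled_def x_reg_scaled_def x_reg_def bern_fps_0 power_int_minus divide_inverse)
  qed
  have "fps_to_fls (bern_scaled a) * fls_X_inv
      = (fls_X_inv * fls_X) * fps_to_fls (x_reg_scaled a) - fls_const (1 / of_nat a) * fls_X_inv"
    by (simp only: eq fps_to_fls_minus fls_times_fps_to_fls fps_X_to_fls fps_const_to_fls
        algebra_simps)
  then show ?thesis by simp
qed

text \<open>
  The binomial expansion of \<open>(1 - E)\<^sup>k\<close>, the source of the binomial coefficients in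
  \<open>C\<close>.
\<close>

lemma diff_word_replicate_D:
  "diff_word f (replicate k D @ w) a
    = (\<Sum>l\<le>k. of_nat (k choose l) * (- 1) ^ l * diff_word f w (a + l))"
proof (induction k arbitrary: a)
  case (Suc k)
  let ?u = "\<lambda>l. (- 1) ^ l * diff_word f w (a + l)"
  have "(\<Sum>l\<le>Suc k. of_nat (Suc k choose l) * ?u l)
      = ?u 0 + (\<Sum>l\<le>k. of_nat (k choose l) * ?u (Suc l)) + (\<Sum>l\<le>k. of_nat (k choose Suc l) * ?u (Suc l))"
    by (subst sum.atMost_Suc_shift)
       (simp only: binomial_Suc_Suc binomial_n_0 of_nat_1 of_nat_add mult_1_left distrib_right sum.distrib add.assoc)
  also have "?u 0 + (\<Sum>l\<le>k. of_nat (k choose l) * ?u (Suc l)) + (\<Sum>l\<le>k. of_nat (k choose Suc l) * ?u (Suc l))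
      = (\<Sum>l\<le>Suc k. of_nat (k choose l) * ?u l) + (\<Sum>l\<le>k. of_nat (k choose l) * ?u (Suc l))"
    by (subst sum.atMost_Suc_shift) simp
  also have "\<dots> = diff_word f (replicate k D @ w) a - diff_word f (replicate k D @ w) (Suc a)"
    by (simp add: Suc mult.assoc sum_negf binomial_eq_0)
  finally show ?case by (simp add: mult.assoc)
qed simp

text \<open>
  The coefficient \<open>C\<close> with its summand 1 replaced by \<open>a\<close>.  This makes a recursion over the
  depth possible: summing out \<open>l\<^sub>1\<close> leaves the same expression at \<open>a + l\<^sub>1\<close>.
\<close>

definition C_shifted :: "nat \<Rightarrow> nat list \<Rightarrow> nat list \<Rightarrow> rat" where
  "C_shifted a ks ms =
     (\<Sum>ls\<in>listset (map (\<lambda>k. {0..k}) ks). \<Prod>i<length ks.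
        of_nat (ks ! i choose ls ! i) * (- 1) ^ (ls ! i + 1) *
        of_nat (sum_list (take (Suc i) ls) + a) powi (int (ms ! i) - 1))"

lemma sum_image_Cons:
  "sum F ((\<lambda>(x, xs). x # xs) ` S) = (\<Sum>(x, xs)\<in>S. F (x # xs))"
  by (subst sum.reindex) (auto simp: inj_on_def intro!: sum.cong)

lemma C_shifted_Cons:
  "C_shifted a (k # ks) (m # ms) = (\<Sum>l\<le>k. of_nat (k choose l) * (- 1) ^ (l + 1) *
     of_nat (a + l) powi (int m - 1) * C_shifted (a + l) ks ms)"
proof -
  let ?L = "listset (map (\<lambda>k. {0..k}) ks)"
  define T where "T a ks ms ls = (\<Prod>i<length ks.
      of_nat (ks ! i choose ls ! i) * (- 1) ^ (ls ! i + 1) *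
      of_nat (sum_list (take (Suc i) ls) + a) powi (int (ms ! i) - 1) :: rat)" for a ks ms ls
  have "listset (map (\<lambda>k. {0..k}) (k # ks)) = (\<lambda>(l, ls). l # ls) ` ({..k} \<times> ?L)"
    by (auto simp: set_Cons_def)
  then have "C_shifted a (k # ks) (m # ms) = (\<Sum>l\<le>k. \<Sum>ls\<in>?L. T a (k # ks) (m # ms) (l # ls))"
    unfolding C_shifted_def T_def by (simp only: sum_image_Cons sum.cartesian_product)
  moreover have "T a (k # ks) (m # ms) (l # ls) = of_nat (k choose l) * (- 1) ^ (l + 1) *
      of_nat (a + l) powi (int m - 1) * T (a + l) ks ms ls" for l ls
    unfolding T_def by (simp add: prod.lessThan_Suc_shift add_ac del: prod.lessThan_Suc)
  ultimately show ?thesis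
    by (simp only: C_shifted_def sum_distrib_left) (simp only: T_def)
qed

text \<open>
  The numerator of \<open>psi_series\<close> over \<open>z\<^sup>n\<close>, with \<open>C_shifted a\<close> in place of
  \<open>C_coeff\<close>.
\<close>

definition psi_fps :: "nat list \<Rightarrow> nat \<Rightarrow> rat fps" where
  "psi_fps ks a = Abs_fps (\<lambda>M. \<Sum>ms | length ms = length ks \<and> sum_list ms = M.
     (\<Prod>i<length ks. fps_nth bern_fps (ms ! i)) * C_shifted a ks ms)"

lemma psi_series_eq: "psi_series ks = fps_to_fls (psi_fps ks 1) * fls_X_inv ^ length ks"
  unfolding psi_series_def psi_fps_def C_shifted_def C_coeff_def Bern_div_fact
  by (simp add: divide_inverse power_inverse flip: fls_inverse_X)

lemma finite_compositions: "finite {ms :: nat list. length ms = n \<and> sum_list ms = M}"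
proof (rule finite_subset)
  show "{ms. length ms = n \<and> sum_list ms = M} \<subseteq> {ms. set ms \<subseteq> {..M} \<and> length ms = n}"
    using member_le_sum_list by auto
qed (simp add: finite_lists_length_eq)

lemma sum_compositions_Suc:
  fixes F :: "nat list \<Rightarrow> 'a::comm_monoid_add"
  shows "(\<Sum>ms | length ms = Suc n \<and> sum_list ms = M. F ms) =
    (\<Sum>m=0..M. \<Sum>ms | length ms = n \<and> sum_list ms = M - m. F (m # ms))"
proof -
  let ?S = "Sigma {0..M} (\<lambda>m. {ms. length ms = n \<and> sum_list ms = M - m})"
  have "{ms. length ms = Suc n \<and> sum_list ms = M} = (\<lambda>(m, ms). m # ms) ` ?S"
    by (force simp: length_Suc_conv image_iff)
  then show ?thesis
    by (simp only: sum_image_Cons) (simp add: sum.Sigma finite_compositions)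
qed

lemma psi_fps_Nil: "psi_fps [] a = 1"
proof (rule fps_ext)
  fix M
  have "{ms :: nat list. ms = [] \<and> sum_list ms = M} = (if M = 0 then {[]} else {})" by auto
  then show "fps_nth (psi_fps [] a) M = fps_nth 1 M"
    by (simp add: psi_fps_def C_shifted_def)
qed

text \<open>
  The sum over compositions of \<open>M\<close> is a Cauchy product, so the first index splits off as a factor
  \<open>bern_scaled\<close>.
\<close>

lemma psi_fps_Cons:
  "psi_fps (k # ks) a
    = (\<Sum>l\<le>k. of_nat (k choose l) * (- 1) ^ l * (bern_scaled (a + l) * psi_fps ks (a + l)))"
proof (rule fps_ext)
  fix M
  let ?c = "\<lambda>l. of_nat (k choose l) * (- 1) ^ l :: rat"
  let ?P = "\<lambda>ms. \<Prod>i<length ks. fps_nth bern_fps (ms ! i)"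
  let ?S = "\<lambda>N. {ms. length ms = length ks \<and> sum_list ms = N}"
  have c: "of_nat (k choose l) * (- 1) ^ l = fps_const (?c l)" for l
    by (simp add: fps_of_nat flip: fps_const_mult fps_const_power fps_const_neg)
  have "fps_nth (psi_fps (k # ks) a) M = (\<Sum>m=0..M. \<Sum>ms\<in>?S (M - m). \<Sum>l\<le>k.
      ?c l * (fps_nth (bern_scaled (a + l)) m * (?P ms * C_shifted (a + l) ks ms)))"
    by (simp add: psi_fps_def sum_compositions_Suc C_shifted_Cons prod.lessThan_Suc_shift
        bern_scaled_def sum_distrib_left mult_ac del: prod.lessThan_Suc)
  also have "\<dots> = (\<Sum>m=0..M. \<Sum>l\<le>k. \<Sum>ms\<in>?S (M - m).
      ?c l * (fps_nth (bern_scaled (a + l)) m * (?P ms * C_shifted (a + l) ks ms)))"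
    by (intro sum.cong refl sum.swap)
  also have "\<dots> = (\<Sum>l\<le>k. \<Sum>m=0..M. \<Sum>ms\<in>?S (M - m).
      ?c l * (fps_nth (bern_scaled (a + l)) m * (?P ms * C_shifted (a + l) ks ms)))"
    by (rule sum.swap)
  also have "\<dots> = fps_nth (\<Sum>l\<le>k. fps_const (?c l) * (bern_scaled (a + l) * psi_fps ks (a + l))) M"
    by (simp only: fps_sum_nth fps_mult_left_const_nth)
       (simp add: fps_mult_nth psi_fps_def sum_distrib_left)
  finally show "fps_nth (psi_fps (k # ks) a) M = fps_nth (\<Sum>l\<le>k. of_nat (k choose l) * (- 1) ^ l *
      (bern_scaled (a + l) * psi_fps ks (a + l))) M"
    by (simp only: c)
qed

lemma yword_Nil: "yword [] = []"
  by (simp add: yword_def)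

lemma yword_Cons: "yword (k # ks) = replicate k D @ Y # yword ks"
  by (simp add: yword_def)

lemma fps_to_fls_sum: "fps_to_fls (sum f S) = (\<Sum>i\<in>S. fps_to_fls (f i))"
  by (induction S rule: infinite_finite_induct) auto

lemma diff_word_yword:
  "diff_word (\<lambda>b. fps_to_fls (bern_scaled b) * fls_X_inv) (yword ks) a
    = fps_to_fls (psi_fps ks a) * fls_X_inv ^ length ks"
proof (induction ks arbitrary: a)
  case Nil
  show ?case by (simp add: yword_Nil psi_fps_Nil)
next
  case (Cons k ks)
  show ?case
    by (simp only: yword_Cons diff_word_replicate_D diff_word.simps Cons)
       (simp add: psi_fps_Cons fps_to_fls_sum fls_times_fps_to_fls fps_to_fls_power
         fps_to_fls_of_nat sum_distrib_right sum_distrib_left mult_ac)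
qed

text \<open>
  The character \<open>psi\<close> is the word evaluated with multiplier \<open>x(a z)\<close> at the point
  \<open>a = 1\<close>; off \<open>Ywords\<close> both sides vanish.
\<close>

lemma psi_eq_diff_word:
  "psi w = diff_word (\<lambda>b. fps_to_fls (x_reg_scaled b) - fls_const (1 / of_nat b) * fls_X_inv) w 1"
proof (cases "w \<in> Ywords")
  case True
  then obtain ks where ks: "w = yword ks" unfolding range_yword[symmetric] by blast
  then show ?thesis
    using True diff_word_yword[of ks 1] inj_yword
    by (simp add: psi_def psi_series_eq bern_scaled_eq)
next
  case False
  then obtain v l where "w = v @ [l]" "l \<noteq> Y"
    by (cases w rule: rev_cases) (auto simp: Ywords_def)
  then have "w = v @ [D]" by (cases l) auto
  with False show ?thesis by (simp add: psi_def diff_word_append_D)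
qed

section \<open>The renormalized values\<close>

lemma phi_plus_eq: "phi_plus = deriv_word (fps_to_fls x_reg)"
proof -
  have phi: "phi = deriv_word (fps_to_fls x_reg - fls_X_inv)"
    by (simp add: fun_eq_iff phi_eq_deriv_word x_series_eq)
  show ?thesis
    unfolding phi_plus_def phi by (intro birkhoff_plus_deriv_word deriv_word_regular)
qed

lemma psi_plus_eq: "psi_plus w = fps_to_fls (diff_word x_reg_scaled w 1)"
proof -
  have psi: "psi = (\<lambda>w. diff_word (\<lambda>b. fps_to_fls (x_reg_scaled b) - fls_const (1 / of_nat b) * fls_X_inv) w 1)"
    by (rule HOL.ext) (rule psi_eq_diff_word)
  have "psi_plus = (\<lambda>w. diff_word (\<lambda>b. fps_to_fls (x_reg_scaled b)) w 1)"
    unfolding psi_plus_def psi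
    by (rule birkhoff_plus_diff_word) (simp add: A_plus_def diff_word_fps_to_fls)
  from fun_cong[OF this] show ?thesis by (simp only: diff_word_fps_to_fls)
qed

lemma count_D_yword: "count_list (yword ks) D = sum_list ks"
proof (induction ks)
  case (Cons k ks)
  have "count_list (replicate k D) D = k" by (induction k) auto
  with Cons show ?case by (simp add: yword_Cons)
qed (simp add: yword_Nil)

lemma limit0_eqI: "has_limit0 f c \<Longrightarrow> limit0 f = c"
  unfolding limit0_def by (rule the_equality) (auto simp: has_limit0_def)

lemma z_fun_has_limit0: "has_limit0 (z_fun ks) (fls_nth (deriv_word (fps_to_fls x_reg) (yword ks)) 0)"
proof -
  define k where "k = sum_list ks"
  define F where "F = diff_word x_reg_scaled (yword ks) 1"
  have low: "\<And>n. n < k \<Longrightarrow> fps_nth F n = 0"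
    and top: "fps_nth F k = (- 1) ^ k * fls_nth (deriv_word (fps_to_fls x_reg) (yword ks)) 0"
    using diff_word_limit[where w = "yword ks" and g = x_reg and a = 1]
    by (simp_all add: F_def k_def count_D_yword flip: x_reg_scaled_def[abs_def])
  \<comment> \<open>The order of vanishing is at least that of the denominator, so the quotient is a power series.\<close>
  have "F = fps_shift k F * fps_X ^ k"
    by (rule fps_ext) (auto simp: fps_X_power_mult_right_nth low)
  then have "fps_to_fls F = fps_to_fls (fps_shift k F) * fls_X ^ k"
    by (metis fls_times_fps_to_fls fps_to_fls_power fps_X_to_fls)
  then have psi: "psi_plus (yword ks) = fps_to_fls (fps_shift k F) * fls_X ^ k"
    by (simp only: psi_plus_eq F_def)
  have cancel: "b \<noteq> 0 \<Longrightarrow> a / b * (c * b) = a * c" for a b c :: laurent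
    by simp
  have "z_fun ks = (- 1) ^ k * fps_to_fls (fps_shift k F)"
    unfolding z_fun_def psi k_def[symmetric] by (rule cancel) simp
  also have "\<dots> = fps_to_fls ((- 1) ^ k * fps_shift k F)"
    by (simp add: fls_times_fps_to_fls fps_to_fls_power)
  finally have "z_fun ks = fps_to_fls ((- 1) ^ k * fps_shift k F)" .
  moreover have "fps_nth ((- 1) ^ k * fps_shift k F) 0 = fls_nth (deriv_word (fps_to_fls x_reg) (yword ks)) 0"
    by (simp add: top fps_nth_power_0 flip: power_mult_distrib mult.assoc)
  ultimately show ?thesis by (simp add: has_limit0_def A_plus_def)
qed

lemma zeta_plus_eq: "zeta_plus ks = fls_nth (deriv_word (fps_to_fls x_reg) (yword ks)) 0"
  unfolding zeta_plus_def phi_plus_eq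
  by (rule limit0_eqI) (simp add: has_limit0_def deriv_word_regular)

lemma z_plus_word_eq:
  assumes "w \<in> Ywords"
  shows "z_plus_word w = fls_nth (deriv_word (fps_to_fls x_reg) w) 0"
proof -
  from assms obtain ks where ks: "w = yword ks" unfolding range_yword[symmetric] by blast
  then show ?thesis
    using inj_yword limit0_eqI[OF z_fun_has_limit0[of ks]]
    by (auto simp: z_plus_word_def z_plus_def)
qed

text \<open>
  On the span of \<open>Ywords\<close> the linear extension is the constant term of a character for
  \<open>\<diamond>\<^sub>0\<close> with regular values, hence multiplicative.
\<close>

lemma z_plus_lin_eq:
  assumes "Poly_Mapping.keys p \<subseteq> Ywords"
  shows "z_plus_lin p = fls_nth (linext (deriv_word (fps_to_fls x_reg)) p) 0"
proof -
  have nth_sum: "fls_nth (sum f S) 0 = (\<Sum>i\<in>S. fls_nth (f i) 0)" for f :: "word \<Rightarrow> laurent" and S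
    by (induction S rule: infinite_finite_induct) auto
  show ?thesis
    unfolding z_plus_lin_def linext_def nth_sum using assms
    by (intro sum.cong) (auto simp: z_plus_word_eq)
qed

theorem theorem4p7:
  shows "(\<forall>ks. (\<exists>c. has_limit0 (z_fun ks) c) \<and> z_plus ks = zeta_plus ks) \<and>
    (\<forall>u\<in>Ywords. \<forall>v\<in>Ywords.
      z_plus_lin (dia0 u v) = z_plus_lin (basis u) * z_plus_lin (basis v))"
proof (intro conjI allI ballI)
  fix ks
  show "\<exists>c. has_limit0 (z_fun ks) c" using z_fun_has_limit0 by blast
  show "z_plus ks = zeta_plus ks"
    unfolding z_plus_def zeta_plus_eq by (rule limit0_eqI[OF z_fun_has_limit0])
next
  fix u v assume uv: "u \<in> Ywords" "v \<in> Ywords"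
  obtain g h where gh: "deriv_word (fps_to_fls x_reg) u = fps_to_fls g"
      "deriv_word (fps_to_fls x_reg) v = fps_to_fls h"
    using deriv_word_regular[of x_reg] unfolding A_plus_def by blast
  have "z_plus_lin (dia0 u v) = fls_nth (fps_to_fls g * fps_to_fls h) 0"
    using keys_dia0[OF uv] by (simp add: z_plus_lin_eq deriv_word_dia0 gh)
  also have "\<dots> = fps_nth g 0 * fps_nth h 0"
    by (simp flip: fls_times_fps_to_fls)
  also have "\<dots> = z_plus_lin (basis u) * z_plus_lin (basis v)"
    using uv by (simp add: z_plus_lin_eq gh)
  finally show "z_plus_lin (dia0 u v) = z_plus_lin (basis u) * z_plus_lin (basis v)" .
qed

end
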